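(* Let $d\ge 2$ and let $\mathcal U$ be an update family on $\mathbb Z^d$. If $\mathcal U$ is subcritical, then $p_{\mathrm c}(\mathcal U)>0$.
   Context: Let $o$ denote the origin of $\mathbb Z^d$. An update family $\mathcal U$ is a finite family of finite subsets of $\mathbb Z^d\setminus\{o\}$. Bootstrap percolation: given a set $X=X_0\subset\mathbb Z^d$ (the sites initially in state $0$; the other sites are in state $1$), define for $t\ge 0$ $$X_{t+1}:=X_t\cup\{i\in\mathbb Z^d:\ \exists U\in\mathcal U \text{ with } i+U\subset X_t\},\qquad [X]:=\bigcup_{t\ge 0}X_t .$$ Let $\mathbb P_p$ be the law under which each site of $\mathbb Z^d$ belongs to $X$ independently with probability $p$. The critical parameter is $$p_{\mathrm c}(\mathcal U):=\inf\{p\in[0,1]:\ \mathbb P_p([X]=\mathbb Z^d)=1\}.$$ Let $S^{d-1}\subset\mathbb R^d$ be the unit sphere and, for $u\in S^{d-1}$, let $\mathbb H_u:=\{v\in\mathbb R^d:\langle v,u\rangle<0\}$. A direction $u\in S^{d-1}$ is stable if $[\mathbb H_u\cap\mathbb Z^d]=\mathbb H_u\cap\mathbb Z^d$. Let $\mathcal S\subset S^{d-1}$ be the set of stable directions. A direction is strongly stable if it is in the interior of $\mathcal S$ relative to $S^{d-1}$. The family $\mathcal U$ is subcritical if every open hemisphere of $S^{d-1}$ contains a strongly stable direction. *)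

theory Defs
  imports "HOL-Probability.Probability"
begin

text \<open>Sites of \<open>\<int>\<^sup>d\<close> have type \<^typ>\<open>int ^ 'd\<close>, where \<open>d = CARD('d)\<close>.\<close>

definition update_family :: "(int ^ 'd) set set \<Rightarrow> bool" where
  "update_family \<U> \<longleftrightarrow> finite \<U> \<and> (\<forall>U\<in>\<U>. finite U \<and> 0 \<notin> U)"

primrec bootstrap :: "(int ^ 'd) set set \<Rightarrow> (int ^ 'd) set \<Rightarrow> nat \<Rightarrow> (int ^ 'd) set" where
  "bootstrap \<U> X 0 = X"
| "bootstrap \<U> X (Suc t) =
     bootstrap \<U> X t \<union> {i. \<exists>U\<in>\<U>. (+) i ` U \<subseteq> bootstrap \<U> X t}"

definition bootstrap_closure :: "(int ^ 'd) set set \<Rightarrow> (int ^ 'd) set \<Rightarrow> (int ^ 'd) set" where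
  "bootstrap_closure \<U> X = (\<Union>t. bootstrap \<U> X t)"

text \<open>A configuration \<open>\<omega>\<close> encodes the initial set as \<open>{i. \<omega> i}\<close>: the value \<^const>\<open>True\<close>
  marks the sites initially in state 0. The parameter is only meaningful in \<open>[0, 1]\<close>.\<close>

definition bernoulli_law :: "real \<Rightarrow> (int ^ 'd::finite \<Rightarrow> bool) measure" where
  "bernoulli_law p = (\<Pi>\<^sub>M i\<in>UNIV. measure_pmf (bernoulli_pmf p))"

definition percolation_event :: "(int ^ 'd) set set \<Rightarrow> (int ^ 'd \<Rightarrow> bool) set" where
  "percolation_event \<U> = {\<omega>. bootstrap_closure \<U> {i. \<omega> i} = UNIV}"

definition critical_prob :: "(int ^ 'd::finite) set set \<Rightarrow> real" where
  "critical_prob \<U> =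
     Inf {p \<in> {0..1}. measure (bernoulli_law p) (percolation_event \<U>) = 1}"

definition real_site :: "int ^ 'd \<Rightarrow> real ^ 'd::finite" where
  "real_site x = (\<chi> k. real_of_int (x $ k))"

definition half_space :: "real ^ 'd::finite \<Rightarrow> (real ^ 'd) set" where
  "half_space u = {v. v \<bullet> u < 0}"

definition lattice_points :: "(real ^ 'd::finite) set \<Rightarrow> (int ^ 'd) set" where
  "lattice_points A = {x. real_site x \<in> A}"

definition stable_directions :: "(int ^ 'd::finite) set set \<Rightarrow> (real ^ 'd) set" where
  "stable_directions \<U> =
     {u \<in> sphere 0 1.
        bootstrap_closure \<U> (lattice_points (half_space u)) = lattice_points (half_space u)}"

definition strongly_stable_directions :: "(int ^ 'd::finite) set set \<Rightarrow> (real ^ 'd) set" where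
  "strongly_stable_directions \<U> =
     (top_of_set (sphere 0 1)) interior_of (stable_directions \<U>)"

definition open_hemisphere :: "real ^ 'd::finite \<Rightarrow> (real ^ 'd) set" where
  "open_hemisphere w = {u \<in> sphere 0 1. u \<bullet> w > 0}"

definition subcritical :: "(int ^ 'd::finite) set set \<Rightarrow> bool" where
  "subcritical \<U> \<longleftrightarrow>
     (\<forall>w \<in> sphere 0 1. open_hemisphere w \<inter> strongly_stable_directions \<U> \<noteq> {})"

text \<open>The facts below rule out two degenerate readings of \<^const>\<open>critical_prob\<close>: the
  measure of a non-measurable set and the infimum of an empty set.\<close>

lemma site_event_measurable:
  "{\<omega>. i \<in> bootstrap \<U> {j. \<omega> j} t} \<in> sets (bernoulli_law p)"
  if "update_family \<U>" for i :: "int ^ 'd::finite"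
proof (induction t arbitrary: i)
  case 0
  have "(\<lambda>\<omega>. \<omega> i) \<in> measurable (bernoulli_law p) (measure_pmf (bernoulli_pmf p))"
    unfolding bernoulli_law_def by (rule measurable_component_singleton) simp
  from measurable_sets[OF this, of "{True}"] show ?case
    by (simp add: bernoulli_law_def space_PiM vimage_def)
next
  case (Suc t)
  have space: "space (bernoulli_law p) = (UNIV :: (int ^ 'd \<Rightarrow> bool) set)"
    by (simp add: bernoulli_law_def space_PiM)
  have U: "finite \<U>" "\<And>U. U \<in> \<U> \<Longrightarrow> finite U"
    using that by (auto simp: update_family_def)
  have pred: "Measurable.pred (bernoulli_law p) (\<lambda>\<omega>. k \<in> bootstrap \<U> {j. \<omega> j} t)" for k
    using Suc[of k] by (simp add: pred_def space)
  have "Measurable.pred (bernoulli_law p)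
      (\<lambda>\<omega>. i \<in> bootstrap \<U> {j. \<omega> j} t \<or> (\<exists>U\<in>\<U>. \<forall>k\<in>U. i + k \<in> bootstrap \<U> {j. \<omega> j} t))"
    using U pred by (intro pred_intros_logic pred_intros_finite) auto
  then show ?case
    by (simp add: pred_def space image_subset_iff)
qed

lemma percolation_event_measurable:
  "percolation_event \<U> \<in> sets (bernoulli_law p)" if "update_family \<U>"
proof -
  have "percolation_event \<U> = (\<Inter>i. \<Union>t. {\<omega>. i \<in> bootstrap \<U> {j. \<omega> j} t})"
    by (auto simp: percolation_event_def bootstrap_closure_def)
  then show ?thesis
    using site_event_measurable[OF that] by (auto intro!: sets.countable_INT'' sets.countable_UN)
qed

lemma one_percolates:
  "measure (bernoulli_law 1) (percolation_event \<U>) = 1"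
  if "update_family \<U>" for \<U> :: "(int ^ 'd::finite) set set"
proof -
  interpret prob_space "bernoulli_law 1 :: (int ^ 'd \<Rightarrow> bool) measure"
    unfolding bernoulli_law_def by (intro prob_space_PiM measure_pmf.prob_space_axioms)
  have "pmf (bernoulli_pmf 1) False = 0"
    by simp
  then have "AE b in measure_pmf (bernoulli_pmf 1). b = True"
    by (metis (full_types) AE_measure_pmf_iff set_pmf_iff)
  then have "AE \<omega> in bernoulli_law 1. \<omega> i = True" for i :: "int ^ 'd"
    unfolding bernoulli_law_def
    by (rule AE_PiM_component[where P = "\<lambda>b. b = True", rotated 2])
       (simp_all add: measure_pmf.prob_space_axioms)
  then have "AE \<omega> in bernoulli_law 1. \<forall>i :: int ^ 'd. \<omega> i"
    by (simp add: AE_all_countable)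
  then have "AE \<omega> in bernoulli_law 1. \<omega> \<in> percolation_event \<U>"
  proof eventually_elim
    case (elim \<omega>)
    then have "bootstrap \<U> {i. \<omega> i} 0 = UNIV"
      by auto
    then show ?case
      unfolding percolation_event_def bootstrap_closure_def by blast
  qed
  then show ?thesis
    using percolation_event_measurable[OF that] by (simp add: prob_eq_1)
qed

end

theory Submission
  imports Defs
begin

text \<open>Subcriticality yields directions \<open>v\<close> with positive weights \<open>c v\<close> such that \<open>\<Sum> c v *\<^sub>R v = 0\<close>
  and every update set contains, for each of these \<open>v\<close>, a site with positive inner product with \<open>v\<close>.
  Hence an infected site outside \<open>X\<close> has, for each \<open>v\<close>, a neighbour infected earlier and lying further
  in direction \<open>v\<close>. Since the rescaled linear forms \<open>L v\<close> sum to \<open>0\<close>, the paths following these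
  neighbours cannot all drift apart and yet be explained by few sites of \<open>X\<close>: as in Toom's contour
  argument, every infected site lies in a finite connected set in which the sites of \<open>X\<close> have density
  at least \<open>1 / C\<close>. There are exponentially many connected sets of a given size, so for small \<open>p\<close> a
  Peierls estimate shows that the origin stays uninfected with positive probability.\<close>

section \<open>Connected sets with many initial sites\<close>

definition links :: "('v \<times> 'v) set \<Rightarrow> 'v set \<Rightarrow> ('v \<times> 'v) set" where
  "links E W = (E \<inter> W \<times> W)\<^sup>*"

lemma links_refl [simp]: "(a, a) \<in> links E W"
  by (simp add: links_def)

lemma links_trans: "(a, b) \<in> links E W \<Longrightarrow> (b, c) \<in> links E W \<Longrightarrow> (a, c) \<in> links E W"
  by (auto simp: links_def)

lemma links_sym: "sym E \<Longrightarrow> (a, b) \<in> links E W \<Longrightarrow> (b, a) \<in> links E W"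
  unfolding links_def
  by (rule symD[OF sym_rtrancl]) (auto simp: sym_def)

lemma links_mono: "V \<subseteq> W \<Longrightarrow> (a, b) \<in> links E V \<Longrightarrow> (a, b) \<in> links E W"
  unfolding links_def by (rule rtrancl_mono[THEN subsetD]) auto

lemma links_step: "(a, b) \<in> E \<Longrightarrow> a \<in> W \<Longrightarrow> b \<in> W \<Longrightarrow> (a, b) \<in> links E W"
  unfolding links_def by blast

lemma links_mem: "(a, b) \<in> links E W \<Longrightarrow> a \<in> W \<Longrightarrow> b \<in> W"
  unfolding links_def by (erule rtranclE) auto

text \<open>Cut the path at its first visit to \<open>y\<close>: the point \<open>c\<close> before
  that visit is reached without touching \<open>y\<close>.\<close>

lemma links_avoid:
  assumes "(a, b) \<in> links E W" and "a \<noteq> y"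
  shows "b \<noteq> y \<and> (a, b) \<in> links E (W - {y}) \<or>
    (\<exists>c\<in>W - {y}. (a, c) \<in> links E (W - {y}) \<and> (c, y) \<in> E)"
  using assms(1) unfolding links_def
proof (induction rule: rtrancl_induct)
  case base
  then show ?case using assms by simp
next
  case (step b c)
  show ?case
  proof (cases "\<exists>c\<in>W - {y}. (a, c) \<in> (E \<inter> (W - {y}) \<times> (W - {y}))\<^sup>* \<and> (c, y) \<in> E")
    case False
    with step have b: "b \<noteq> y" "(a, b) \<in> (E \<inter> (W - {y}) \<times> (W - {y}))\<^sup>*"
      by blast+
    with False step have "c \<noteq> y" by blast
    with b step have "(b, c) \<in> E \<inter> (W - {y}) \<times> (W - {y})" by blast
    with b \<open>c \<noteq> y\<close> show ?thesis by (meson rtrancl.rtrancl_into_rtrancl)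
  qed blast
qed

definition connected_in :: "('v \<times> 'v) set \<Rightarrow> 'v set \<Rightarrow> bool" where
  "connected_in E A \<longleftrightarrow> (\<forall>a\<in>A. \<forall>b\<in>A. (a, b) \<in> links E A)"

lemma connected_in_insert:
  assumes "sym E" "connected_in E A" "b \<in> A" "(y, b) \<in> E"
  shows "connected_in E (insert y A)"
proof -
  have "(y, b) \<in> links E (insert y A)"
    using assms by (intro links_step) auto
  moreover have "(c, d) \<in> links E (insert y A)" if "c \<in> A" "d \<in> A" for c d
    using assms that links_mono[of A "insert y A" c d E] by (auto simp: connected_in_def)
  ultimately have "(c, b) \<in> links E (insert y A)" if "c \<in> insert y A" for c
    using that assms by auto
  then show ?thesis
    unfolding connected_in_def using links_trans links_sym[OF assms(1)] by metis
qed

lemma connected_in_insert_UN: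
  assumes "sym E" "\<And>k. k \<in> K \<Longrightarrow> connected_in E (A k)"
    and "\<And>k. k \<in> K \<Longrightarrow> w k \<in> A k" "\<And>k. k \<in> K \<Longrightarrow> (y, w k) \<in> E"
  shows "connected_in E (insert y (\<Union>k\<in>K. A k))" (is "connected_in E ?B")
proof -
  have "(c, y) \<in> links E ?B" if "c \<in> ?B" for c
  proof (cases "c = y")
    case False
    with that obtain k where k: "k \<in> K" "c \<in> A k" by auto
    then have "connected_in E (insert y (A k))"
      by (intro connected_in_insert[where b = "w k"] assms)
    then have "(c, y) \<in> links E (insert y (A k))"
      using k by (auto simp: connected_in_def)
    then show ?thesis by (rule links_mono[rotated]) (use k in auto)
  qed simp
  then show ?thesis
    unfolding connected_in_def using links_trans links_sym[OF assms(1)] by metis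
qed

text \<open>Abstracts the infection history. In the application \<open>V\<close> is the closure of
  \<open>X\<close>, \<open>f i y\<close> is a site infected before \<open>y\<close>, taken from an
  update set that infects \<open>y\<close> and lying further in direction \<open>i\<close>, and
  \<open>L i\<close> is the rescaled linear form of that direction.\<close>

locale explanation =
  fixes I :: "'i set" and V X :: "'v set" and f :: "'i \<Rightarrow> 'v \<Rightarrow> 'v"
    and L :: "'i \<Rightarrow> 'v \<Rightarrow> real" and age :: "'v \<Rightarrow> nat" and \<Lambda> C :: real
  assumes finite_I: "finite I" and I_nonempty: "I \<noteq> {}"
    and sum_L: "\<And>v. (\<Sum>i\<in>I. L i v) = 0"
    and f_V: "\<And>i y. y \<in> V - X \<Longrightarrow> i \<in> I \<Longrightarrow> f i y \<in> V"
    and age_f: "\<And>i y. y \<in> V - X \<Longrightarrow> i \<in> I \<Longrightarrow> age (f i y) < age y"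
    and gain: "\<And>i y. y \<in> V - X \<Longrightarrow> i \<in> I \<Longrightarrow> L i y + 1 \<le> L i (f i y)"
    and bounded: "\<And>i j y. y \<in> V - X \<Longrightarrow> i \<in> I \<Longrightarrow> j \<in> I \<Longrightarrow> L i (f j y) \<le> L i y + \<Lambda>"
    and C: "2 + card I * \<Lambda> \<le> C" "1 \<le> C"
begin

definition arrows :: "('v \<times> 'v) set" where
  "arrows = {(y, z). y \<in> V - X \<and> (\<exists>i\<in>I. z = f i y) \<or> z \<in> V - X \<and> (\<exists>i\<in>I. y = f i z)}"

lemma sym_arrows: "sym arrows"
  by (auto simp: sym_def arrows_def)

text \<open>The tuple \<open>v\<close> places one charge of each type. Pushing the charges along \<^term>\<open>f\<close> increases
  \<open>\<Sum>i\<in>I. L i (v i)\<close> by one per move, while charges gathered in one point contribute \<open>0\<close>.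
  Removing a point \<open>y\<close> of maximal age may disconnect the charges; then every component containing
  one receives a full set of charges, the missing ones sitting next to \<open>y\<close>. This costs a bounded
  amount, paid for by the additional point of \<^term>\<open>X\<close> that each further component provides.\<close>

lemma dense_connected_set:
  assumes "finite W" "W \<subseteq> V" "\<And>y i. y \<in> W - X \<Longrightarrow> i \<in> I \<Longrightarrow> f i y \<in> W"
    and "\<And>i. i \<in> I \<Longrightarrow> v i \<in> W"
    and "\<And>i j. i \<in> I \<Longrightarrow> j \<in> I \<Longrightarrow> (v i, v j) \<in> links arrows W"
  shows "\<exists>A\<subseteq>W. v ` I \<subseteq> A \<and> connected_in arrows A \<and>
    card A + (\<Sum>i\<in>I. L i (v i)) \<le> C * (real (card (A \<inter> X)) - 1) + 1"
  using assms
proof (induction "card W" arbitrary: W v rule: less_induct)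
  case less
  note links_sym = links_sym[OF sym_arrows]
  obtain i0 where i0: "i0 \<in> I" using I_nonempty by auto
  have "W \<noteq> {}" using less.prems(4) i0 by auto
  then obtain y where y: "y \<in> W" and y_max: "\<And>z. z \<in> W \<Longrightarrow> age z \<le> age y"
    using less.prems(1) Max_in[of "age ` W"] Max_ge[of "age ` W"] by fastforce
  define W' where "W' = W - {y}"
  have W': "card W' < card W" "finite W'" "W' \<subseteq> V" "W' \<subseteq> W"
    using y less.prems(1,2) card_Diff1_less[OF less.prems(1) y] by (auto simp only: W'_def)
  \<comment> \<open>Ages drop along \<open>f\<close>, so no point of \<open>W - X\<close> is mapped
    to \<open>y\<close>, whose age is maximal; hence \<open>W'\<close> stays closed under
    \<open>f\<close>.\<close>
  have f_y: "f i z \<noteq> y" if "z \<in> W - X" "i \<in> I" for i z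
    using age_f[of z i] y_max[of z] that less.prems by force
  have W'_closed: "f i z \<in> W'" if "z \<in> W' - X" "i \<in> I" for i z
    using f_y[of z i] less.prems(3)[of z i] that by (auto simp: W'_def)
  have IH: "\<exists>A\<subseteq>W'. x ` I \<subseteq> A \<and> connected_in arrows A \<and>
      card A + (\<Sum>i\<in>I. L i (x i)) \<le> C * (real (card (A \<inter> X)) - 1) + 1"
    if "\<And>i. i \<in> I \<Longrightarrow> x i \<in> W'" "\<And>i j. i \<in> I \<Longrightarrow> j \<in> I \<Longrightarrow> (x i, x j) \<in> links arrows W'" for x
    by (rule less.hyps[OF W'(1,2,3)]) (fact W'_closed that)+
  \<comment> \<open>The only neighbours of \<open>y\<close> within \<open>W\<close> are thus its own
    images \<open>f i y\<close>, and there are none if \<open>y\<close> is in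
    \<open>X\<close>.\<close>
  have nbr: "y \<notin> X \<and> (\<exists>i\<in>I. c = f i y)" if "(c, y) \<in> arrows" "c \<in> W" for c
    using that f_y[of c] by (auto simp: arrows_def)
  have split: "(a, b) \<in> links arrows W' \<or> y \<notin> X \<and> (\<exists>i\<in>I. (a, f i y) \<in> links arrows W')"
    if "(a, b) \<in> links arrows W" "a \<noteq> y" for a b
    using links_avoid[OF that] nbr unfolding W'_def by blast
  show ?case
  proof (cases "y \<in> X")
    case True
    show ?thesis
    proof (cases "\<exists>i\<in>I. v i = y")
      case yv: True
      \<comment> \<open>As \<open>y\<close> is isolated in \<open>W\<close>, one charge at
        \<open>y\<close> forces all of them there. Then \<open>{y}\<close> gives equality: one
        point, one point of \<open>X\<close>, and total charge 0.\<close>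
      have "v i = y" if "i \<in> I" for i
      proof (rule ccontr)
        assume "v i \<noteq> y"
        moreover obtain j where "j \<in> I" "v j = y" using yv by auto
        ultimately have "(v i, y) \<in> links arrows W'"
          using split[of "v i" y] less.prems(5)[of i j] that True by auto
        then have "y \<in> W'"
          using links_mem \<open>v i \<noteq> y\<close> less.prems(4)[OF that] by (fastforce simp: W'_def)
        then show False by (simp add: W'_def)
      qed
      then have "(\<Sum>i\<in>I. L i (v i)) = 0" "v ` I \<subseteq> {y}"
        using sum_L[of y] by (auto cong: sum.cong)
      then show ?thesis
        using y True by (intro exI[of _ "{y}"]) (auto simp: connected_in_def)
    next
      case False
      then have "v i \<in> W'" if "i \<in> I" for i
        using less.prems(4)[OF that] that by (auto simp: W'_def)
      moreover have "(v i, v j) \<in> links arrows W'" if "i \<in> I" "j \<in> I" for i j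
        using split[OF less.prems(5)[OF that]] True False that by blast
      ultimately obtain A where "A \<subseteq> W'" "v ` I \<subseteq> A" "connected_in arrows A"
        "card A + (\<Sum>i\<in>I. L i (v i)) \<le> C * (real (card (A \<inter> X)) - 1) + 1"
        using IH[of v] by blast
      then show ?thesis using W'(4) by (intro exI[of _ A]) auto
    qed
  next
    case y_X: False
    with y less.prems have yVX: "y \<in> V - X" by auto
    \<comment> \<open>Charges at \<open>y\<close> are pushed along \<open>f\<close>, each by its own
      type, and the others stay. All then lie in \<open>W'\<close> and are linked in
      \<open>W\<close>, though perhaps no longer in \<open>W'\<close>.\<close>
    define v' where "v' i = (if v i = y then f i y else v i)" for i
    have fy_W: "f i y \<in> W'" if "i \<in> I" for i
      using that less.prems(3)[of y i] f_y[of y i] y y_X by (auto simp: W'_def)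
    have v'_W: "v' i \<in> W'" if "i \<in> I" for i
      using that fy_W less.prems(4)[of i] by (auto simp: v'_def W'_def)
    have y_arrow: "(y, f i y) \<in> arrows" if "i \<in> I" for i
      using that yVX by (auto simp: arrows_def)
    have vv': "(v i, v' i) \<in> links arrows W" if "i \<in> I" for i
      using y_arrow[OF that] y fy_W[OF that] W'(4) that
      by (auto simp: v'_def intro!: links_step)
    have v'_links: "(v' i, v' j) \<in> links arrows W" if "i \<in> I" "j \<in> I" for i j
      using vv' that less.prems(5) links_sym links_trans by metis
    have L_v': "L i (v i) \<le> L i (v' i)" if "i \<in> I" for i
      using gain[OF yVX that] by (auto simp: v'_def)
    show ?thesis
    proof (cases "\<forall>i\<in>I. \<forall>j\<in>I. (v' i, v' j) \<in> links arrows W'")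
      case True
      then obtain A where A: "A \<subseteq> W'" "v' ` I \<subseteq> A" "connected_in arrows A"
        "card A + (\<Sum>i\<in>I. L i (v' i)) \<le> C * (real (card (A \<inter> X)) - 1) + 1"
        using IH[of v'] v'_W by blast
      show ?thesis
      proof (cases "\<exists>i\<in>I. v i = y")
        case yv: True
        then obtain i where i: "i \<in> I" "v i = y" by auto
        have "connected_in arrows (insert y A)"
          using A i y_arrow by (intro connected_in_insert[where b = "f i y"] sym_arrows)
            (auto simp: v'_def)
        moreover have "v ` I \<subseteq> insert y A"
          using A(2) by (auto simp: v'_def split: if_splits)
        moreover have "card (insert y A) = card A + 1"
          using A W' finite_subset[OF A(1)] by (subst card_insert_disjoint) (auto simp: W'_def)
        \<comment> \<open>At least one charge has moved, and its gain of 1 pays for adding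
          \<open>y\<close>.\<close>
        moreover have "(\<Sum>i\<in>I. L i (v i)) + 1 \<le> (\<Sum>i\<in>I. L i (v' i))"
        proof -
          have "(\<Sum>j\<in>I. L j (v j)) + 1 = (L i (v i) + 1) + (\<Sum>j\<in>I-{i}. L j (v j))"
            using i finite_I by (simp add: sum.remove)
          also have "\<dots> \<le> L i (v' i) + (\<Sum>j\<in>I-{i}. L j (v' j))"
            using i gain[OF yVX i(1)] L_v' by (intro add_mono sum_mono) (auto simp: v'_def)
          finally show ?thesis using i finite_I by (simp add: sum.remove)
        qed
        moreover have "insert y A \<inter> X = A \<inter> X" using y_X by auto
        moreover have "insert y A \<subseteq> W" using A(1) y by (auto simp: W'_def)
        ultimately show ?thesis using A(4) by (intro exI[of _ "insert y A"]) auto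
      next
        case False
        then have "v' i = v i" if "i \<in> I" for i using that by (auto simp: v'_def)
        then have "v' ` I = v ` I" "(\<Sum>i\<in>I. L i (v' i)) = (\<Sum>i\<in>I. L i (v i))"
          by (auto intro: sum.cong)
        then show ?thesis using A W'(4) by (intro exI[of _ A]) auto
      qed
    next
      case False
      then obtain j1 j2 where j12: "j1 \<in> I" "j2 \<in> I" "(v' j1, v' j2) \<notin> links arrows W'"
        by auto
      \<comment> \<open>The component of \<open>W'\<close> that contains charge \<open>i\<close>.
        Collecting components as sets in \<open>K\<close> counts one shared by several charges only
        once.\<close>
      define cls where "cls i = {z. (v' i, z) \<in> links arrows W'}" for i
      have cls_eq: "cls i = cls j \<longleftrightarrow> (v' i, v' j) \<in> links arrows W'" for i j
      proof
        assume "cls i = cls j"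
        moreover have "v' j \<in> cls j" by (simp add: cls_def)
        ultimately show "(v' i, v' j) \<in> links arrows W'" by (simp add: cls_def set_eq_iff)
      next
        assume "(v' i, v' j) \<in> links arrows W'"
        then show "cls i = cls j"
          by (auto simp: cls_def intro: links_trans links_trans[OF links_sym])
      qed
      have cls_mem: "v' i \<in> cls j \<longleftrightarrow> cls i = cls j" for i j
        unfolding cls_eq using links_sym by (auto simp: cls_def)
      define K where "K = cls ` I"
      have K: "finite K" "cls j1 \<in> K" "cls j2 \<in> K" "cls j1 \<noteq> cls j2"
        using finite_I j12 by (auto simp: K_def cls_eq)
      have card_K: "card K \<ge> 2"
        using card_mono[of K "{cls j1, cls j2}"] K by simp
      \<comment> \<open>A path in \<open>W\<close> from this charge to one in another component must
        visit \<open>y\<close>, and it first enters \<open>y\<close> from some \<open>f j y\<close>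
        in the present component.\<close>
      have "\<exists>j\<in>I. f j y \<in> cls i" if "i \<in> I" for i
      proof -
        obtain j where j: "j \<in> I" "(v' i, v' j) \<notin> links arrows W'"
          using j12 links_trans links_sym by metis
        have "v' i \<noteq> y" using v'_W[OF that] by (auto simp: W'_def)
        then show ?thesis
          using split[OF v'_links[OF that j(1)]] j by (auto simp: cls_def)
      qed
      then have "\<forall>k\<in>K. \<exists>j\<in>I. f j y \<in> k" by (auto simp: K_def)
      then obtain g where g: "\<And>k. k \<in> K \<Longrightarrow> g k \<in> I" "\<And>k. k \<in> K \<Longrightarrow> f (g k) y \<in> k"
        by metis
      define w where "w k = f (g k) y" for k
      \<comment> \<open>In component \<open>k\<close> the charges already present stay; the missing
        types are placed at \<open>w k\<close>, next to \<open>y\<close>.\<close>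
      define u where "u k i = (if v' i \<in> k then v' i else w k)" for k i
      have K_links: "(a, b) \<in> links arrows W'" if "k \<in> K" "a \<in> k" "b \<in> k" for a b k
        using that by (auto simp: K_def cls_def intro: links_trans[OF links_sym])
      have K_eq: "b \<in> k" if "k \<in> K" "a \<in> k" "(a, b) \<in> links arrows W'" for a b k
        using that by (auto simp: K_def cls_def intro: links_trans)
      have K_disj: "k \<inter> k' = {}" if "k \<in> K" "k' \<in> K" "k \<noteq> k'" for k k'
        using that K_eq K_links by blast
      have u_k: "u k i \<in> k" if "k \<in> K" for k i
        using that g(2) by (auto simp: u_def w_def)
      have u_W: "u k i \<in> W'" if "k \<in> K" "i \<in> I" for k i
        using that g(1) v'_W fy_W by (auto simp: u_def w_def)
      have "\<exists>A\<subseteq>W'. u k ` I \<subseteq> A \<and> connected_in arrows A \<and>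
          card A + (\<Sum>i\<in>I. L i (u k i)) \<le> C * (real (card (A \<inter> X)) - 1) + 1" if "k \<in> K" for k
        using that u_W u_k K_links by (intro IH) auto
      then obtain A where A: "\<And>k. k \<in> K \<Longrightarrow> A k \<subseteq> W'" "\<And>k. k \<in> K \<Longrightarrow> u k ` I \<subseteq> A k"
        "\<And>k. k \<in> K \<Longrightarrow> connected_in arrows (A k)"
        "\<And>k. k \<in> K \<Longrightarrow>
          card (A k) + (\<Sum>i\<in>I. L i (u k i)) \<le> C * (real (card (A k \<inter> X)) - 1) + 1"
        by metis
      have A_k: "A k \<subseteq> k" if "k \<in> K" for k
      proof
        fix a assume "a \<in> A k"
        moreover have "u k i0 \<in> A k" using A(2)[OF that] i0 by auto
        ultimately have "(u k i0, a) \<in> links arrows W'"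
          using A(3)[OF that] links_mono[OF A(1)[OF that]] by (auto simp: connected_in_def)
        then show "a \<in> k" using K_eq[OF that u_k[OF that]] by blast
      qed
      have finA: "finite (A k)" if "k \<in> K" for k
        using A(1)[OF that] W'(2) by (rule finite_subset)
      have A_disj: "A k \<inter> A k' = {}" if "k \<in> K" "k' \<in> K" "k \<noteq> k'" for k k'
        using K_disj[OF that] A_k that by blast
      \<comment> \<open>There are at least two components, so some charge is missing from
        \<open>k\<close> and has been placed at \<open>w k\<close>. This makes \<open>A k\<close>
        adjacent to \<open>y\<close>.\<close>
      have w_A: "w k \<in> A k" if k: "k \<in> K" for k
      proof -
        have "\<exists>i\<in>I. cls i \<noteq> k" using K(4) j12 by auto
        moreover obtain i' where "i' \<in> I" "k = cls i'" using k by (auto simp: K_def)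
        ultimately obtain i where "i \<in> I" "v' i \<notin> k" using cls_mem by auto
        then have "u k i = w k" by (simp add: u_def)
        with \<open>i \<in> I\<close> show ?thesis using A(2)[OF k] by force
      qed
      define B where "B = insert y (\<Union>k\<in>K. A k)"
      have UN_W': "(\<Union>k\<in>K. A k) \<subseteq> W'" using A(1) by blast
      have "connected_in arrows B"
        unfolding B_def using A(3) w_A g(1) y_arrow
        by (intro connected_in_insert_UN[where w = w] sym_arrows) (auto simp: w_def)
      moreover have "B \<subseteq> W" using UN_W' W'(4) y by (auto simp: B_def)
      moreover have "v ` I \<subseteq> B"
      proof
        fix x assume "x \<in> v ` I"
        then obtain i where i: "i \<in> I" "x = v i" by auto
        show "x \<in> B"
        proof (cases "v i = y")
          case False
          then have "u (cls i) i = v i" using cls_mem[of i i] by (auto simp: u_def v'_def)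
          moreover have "cls i \<in> K" using i by (simp add: K_def)
          ultimately show ?thesis using A(2)[of "cls i"] i by (force simp: B_def)
        qed (simp add: B_def i)
      qed
      moreover have "card B + (\<Sum>i\<in>I. L i (v i)) \<le> C * (real (card (B \<inter> X)) - 1) + 1"
      proof -
        have "card (\<Union>k\<in>K. A k) = (\<Sum>k\<in>K. card (A k))"
          using K(1) finA A_disj by (intro card_UN_disjoint) auto
        moreover have "y \<notin> (\<Union>k\<in>K. A k)" using UN_W' by (auto simp: W'_def)
        ultimately have card_B: "card B = 1 + (\<Sum>k\<in>K. card (A k))"
          using finA K(1) by (simp add: B_def)
        have "B \<inter> X = (\<Union>k\<in>K. A k \<inter> X)" using y_X by (auto simp: B_def)
        also have "card \<dots> = (\<Sum>k\<in>K. card (A k \<inter> X))"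
          using K(1) finA A_disj by (intro card_UN_disjoint) blast+
        finally have card_BX: "card (B \<inter> X) = (\<Sum>k\<in>K. card (A k \<inter> X))" .
        \<comment> \<open>The charge of type \<open>i\<close> lies in exactly one component,
          \<open>cls i\<close>; in every other one its substitute sits at
          \<open>w k\<close>.\<close>
        have u_sum: "(\<Sum>k\<in>K. L i (u k i)) = L i (v' i) + (\<Sum>k\<in>K. L i (w k)) - L i (w (cls i))"
          if i: "i \<in> I" for i
        proof -
          have ci: "cls i \<in> K" using i by (simp add: K_def)
          have "L i (u k i) = L i (w k)" if "k \<in> K - {cls i}" for k
          proof -
            have "v' i \<notin> k" using that by (auto simp: K_def cls_mem)
            then show ?thesis by (simp add: u_def)
          qed
          then have "(\<Sum>k\<in>K - {cls i}. L i (u k i)) = (\<Sum>k\<in>K - {cls i}. L i (w k))"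
            by (rule sum.cong[OF refl])
          moreover have "u (cls i) i = v' i" using cls_mem[of i i] by (simp add: u_def)
          ultimately show ?thesis using ci K(1) by (simp add: sum.remove)
        qed
        \<comment> \<open>Every \<open>w k\<close> is an image of \<open>y\<close>, so each term
          exceeds \<open>L i y\<close> by at most \<open>\<Lambda>\<close>, and the values at
          \<open>y\<close> add up to 0.\<close>
        have w_bound: "(\<Sum>i\<in>I. L i (w (cls i))) \<le> card I * \<Lambda>"
        proof -
          have "(\<Sum>i\<in>I. L i (w (cls i))) \<le> (\<Sum>i\<in>I. L i y + \<Lambda>)"
            using g(1) by (intro sum_mono) (auto simp: w_def K_def intro!: bounded[OF yVX])
          also have "\<dots> = card I * \<Lambda>" by (simp add: sum.distrib sum_L)
          finally show ?thesis .
        qed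
        have "(\<Sum>k\<in>K. \<Sum>i\<in>I. L i (u k i)) = (\<Sum>i\<in>I. \<Sum>k\<in>K. L i (u k i))"
          by (rule sum.swap)
        also have "\<dots> = (\<Sum>i\<in>I. L i (v' i)) + (\<Sum>i\<in>I. \<Sum>k\<in>K. L i (w k)) - (\<Sum>i\<in>I. L i (w (cls i)))"
          by (simp add: u_sum sum.distrib sum_subtractf)
        also have "(\<Sum>i\<in>I. \<Sum>k\<in>K. L i (w k)) = (\<Sum>k\<in>K. \<Sum>i\<in>I. L i (w k))"
          by (rule sum.swap)
        also have "\<dots> = 0" by (simp add: sum_L)
        finally have "(\<Sum>i\<in>I. L i (v' i)) \<le> (\<Sum>k\<in>K. \<Sum>i\<in>I. L i (u k i)) + card I * \<Lambda>"
          using w_bound by simp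
        moreover have "(\<Sum>i\<in>I. L i (v i)) \<le> (\<Sum>i\<in>I. L i (v' i))"
          using L_v' by (rule sum_mono)
        moreover have "(\<Sum>k\<in>K. card (A k) + (\<Sum>i\<in>I. L i (u k i)))
            \<le> (\<Sum>k\<in>K. C * (real (card (A k \<inter> X)) - 1) + 1)"
          using A(4) by (intro sum_mono) auto
        moreover have "(\<Sum>k\<in>K. C * (real (card (A k \<inter> X)) - 1) + 1)
            = C * card (B \<inter> X) - (C - 1) * card K"
          by (simp add: card_BX sum.distrib sum_subtractf sum_distrib_left algebra_simps)
        \<comment> \<open>Each component contributes \<open>- (C - 1)\<close>, but the goal contains
          this term only once. The second one pays 1 for \<open>y\<close> and
          \<open>card I * \<Lambda>\<close> for the substituted charges, which is the condition
          \<open>2 + card I * \<Lambda> \<le> C\<close>.\<close>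
        moreover have "(C - 1) * 2 \<le> (C - 1) * card K"
          using C card_K by (intro mult_left_mono) auto
        ultimately show ?thesis
          using C(1) by (simp add: card_B sum.distrib algebra_simps)
      qed
      ultimately show ?thesis by blast
    qed
  qed
qed

text \<open>Iterate \<open>f\<close> from \<open>y\<close> and stop in \<open>X\<close>: ages drop
  and \<open>I\<close> is finite, so finitely many points arise even if \<open>V\<close> is
  infinite. This supplies the set \<open>W\<close> for \<open>dense_connected_set\<close>.\<close>

lemma finite_closed_superset:
  assumes "y \<in> V"
  shows "\<exists>W\<subseteq>V. finite W \<and> y \<in> W \<and> (\<forall>z\<in>W - X. \<forall>i\<in>I. f i z \<in> W)"
  using assms
proof (induction "age y" arbitrary: y rule: less_induct)
  case less
  show ?case
  proof (cases "y \<in> X")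
    case True
    then show ?thesis using less.prems by (intro exI[of _ "{y}"]) auto
  next
    case False
    have "\<forall>i\<in>I. \<exists>W. W \<subseteq> V \<and> finite W \<and> f i y \<in> W \<and> (\<forall>z\<in>W - X. \<forall>j\<in>I. f j z \<in> W)"
    proof
      fix i assume "i \<in> I"
      then show "\<exists>W. W \<subseteq> V \<and> finite W \<and> f i y \<in> W \<and> (\<forall>z\<in>W - X. \<forall>j\<in>I. f j z \<in> W)"
        using False less.prems by (intro less.hyps age_f f_V) auto
    qed
    then obtain W where "\<forall>i\<in>I. W i \<subseteq> V \<and> finite (W i) \<and> f i y \<in> W i \<and>
        (\<forall>z\<in>W i - X. \<forall>j\<in>I. f j z \<in> W i)"
      by (rule bchoice[THEN exE])
    then have W: "\<And>i. i \<in> I \<Longrightarrow> W i \<subseteq> V" "\<And>i. i \<in> I \<Longrightarrow> finite (W i)"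
      "\<And>i. i \<in> I \<Longrightarrow> f i y \<in> W i" "\<And>i z j. i \<in> I \<Longrightarrow> z \<in> W i - X \<Longrightarrow> j \<in> I \<Longrightarrow> f j z \<in> W i"
      by auto
    have "f j z \<in> insert y (\<Union>i\<in>I. W i)" if "z \<in> insert y (\<Union>i\<in>I. W i) - X" "j \<in> I" for j z
      using that W(3,4) by blast
    moreover have "finite (insert y (\<Union>i\<in>I. W i))" using W(2) finite_I by simp
    moreover have "insert y (\<Union>i\<in>I. W i) \<subseteq> V" using W(1) less.prems by blast
    ultimately show ?thesis by (intro exI[of _ "insert y (\<Union>i\<in>I. W i)"]) blast
  qed
qed

text \<open>Put all charges at \<open>y\<close>, where they cancel; the remaining constant
  \<open>1 - C\<close> is at most 0.\<close>

corollary dense_connected_set_at: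
  assumes "y \<in> V"
  shows "\<exists>A. finite A \<and> y \<in> A \<and> connected_in arrows A \<and> card A \<le> C * card (A \<inter> X)"
proof -
  obtain W where W: "W \<subseteq> V" "finite W" "y \<in> W" "\<And>z i. z \<in> W - X \<Longrightarrow> i \<in> I \<Longrightarrow> f i z \<in> W"
    using finite_closed_superset[OF assms] by blast
  then obtain A where A: "A \<subseteq> W" "(\<lambda>_. y) ` I \<subseteq> A" "connected_in arrows A"
    "card A + (\<Sum>i\<in>I. L i y) \<le> C * (real (card (A \<inter> X)) - 1) + 1"
    using dense_connected_set[of W "\<lambda>_. y"] by auto
  have "card A \<le> C * card (A \<inter> X)"
    using A(4) C(2) by (simp add: sum_L algebra_simps)
  moreover have "y \<in> A" using A(2) I_nonempty by auto
  ultimately show ?thesis using A(1,3) W(2) finite_subset by blast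
qed

end

lemma connected_in_mono:
  assumes "connected_in E A" "E \<subseteq> F"
  shows "connected_in F A"
proof -
  have "links E A \<subseteq> links F A"
    unfolding links_def using assms(2) by (intro rtrancl_mono) auto
  then show ?thesis using assms(1) by (auto simp: connected_in_def)
qed

section \<open>Counting connected sets\<close>

definition walks :: "('v \<times> 'v) set \<Rightarrow> 'v \<Rightarrow> nat \<Rightarrow> 'v list set" where
  "walks E a n = {xs. length xs = Suc n \<and> hd xs = a \<and> successively (\<lambda>x y. (x, y) \<in> E) xs}"

lemma walks_0: "walks E a 0 = {[a]}"
  by (auto simp: walks_def length_Suc_conv)

lemma walks_Suc: "walks E a (Suc n) = (\<Union>b\<in>E `` {a}. (#) a ` walks E b n)"
  by (auto simp: walks_def length_Suc_conv successively_Cons image_iff)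

lemma finite_card_walks:
  assumes "\<And>a. finite (E `` {a})" "\<And>a. card (E `` {a}) \<le> \<Delta>"
  shows "finite (walks E a n) \<and> card (walks E a n) \<le> \<Delta> ^ n"
proof (induction n arbitrary: a)
  case (Suc n)
  have "card (walks E a (Suc n)) \<le> (\<Sum>b\<in>E `` {a}. card ((#) a ` walks E b n))"
    unfolding walks_Suc by (rule card_UN_le) (rule assms)
  also have "\<dots> \<le> (\<Sum>b\<in>E `` {a}. \<Delta> ^ n)"
    using Suc card_image_le le_trans by (intro sum_mono) blast
  also have "\<dots> \<le> \<Delta> * \<Delta> ^ n"
    using assms(2) by simp
  finally show ?case
    using Suc assms(1) by (auto simp: walks_Suc)
qed (simp add: walks_0)

lemma links_leave:
  assumes "(a, b) \<in> links E A" "a \<in> B" "b \<notin> B"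
  shows "\<exists>c\<in>B. \<exists>d\<in>A - B. (c, d) \<in> E"
  using assms(1,3) unfolding links_def
proof (induction rule: rtrancl_induct)
  case (step b c)
  then show ?case by (cases "b \<in> B") auto
qed (use assms in simp)

text \<open>A new point is visited by a detour of two steps from one of its neighbours.\<close>

lemma covering_walk:
  assumes "finite A" "a \<in> A" "connected_in E A" "sym E"
  shows "\<exists>xs\<in>walks E a (2 * (card A - 1)). set xs = A"
proof -
  have "\<exists>xs\<in>walks E a (2 * n). set xs \<subseteq> A \<and> card (set xs) = Suc n" if "n < card A" for n
    using that
  proof (induction n)
    case 0
    then show ?case using assms by (simp add: walks_0)
  next
    case (Suc n)
    then obtain xs where xs: "xs \<in> walks E a (2 * n)" "set xs \<subseteq> A" "card (set xs) = Suc n"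
      by auto
    have "set xs \<noteq> A" using xs(3) Suc.prems by auto
    then obtain b where b: "b \<in> A" "b \<notin> set xs" using xs by blast
    have a: "a \<in> set xs" using xs(1) by (cases xs) (auto simp: walks_def)
    have "(a, b) \<in> links E A" using assms b by (auto simp: connected_in_def)
    then obtain c d where cd: "c \<in> set xs" "d \<in> A - set xs" "(c, d) \<in> E"
      using links_leave a b by metis
    from cd obtain ys zs where yz: "xs = ys @ c # zs" by (meson split_list)
    have "(d, c) \<in> E" using cd assms(4) by (auto dest: symD)
    then have "ys @ c # d # c # zs \<in> walks E a (2 * Suc n)"
      using xs(1) cd(3) by (cases ys) (auto simp: walks_def yz successively_append_iff successively_Cons hd_append)
    moreover have "set (ys @ c # d # c # zs) = insert d (set xs)" by (auto simp: yz)
    moreover have "card (insert d (set xs)) = Suc (Suc n)" using xs(3) cd(2) by simp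
    ultimately show ?case using xs(2) cd(2) by (metis DiffD1 insert_subset)
  qed
  moreover have "card A > 0" using assms by (auto simp: card_gt_0_iff)
  ultimately obtain xs where "xs \<in> walks E a (2 * (card A - 1))" "set xs \<subseteq> A" "card (set xs) = card A"
    by (metis Suc_diff_1 diff_less zero_less_one)
  then show ?thesis using assms(1) card_subset_eq by metis
qed

section \<open>Cylinder probabilities and the Peierls estimate\<close>

lemma bernoulli_law_all_True:
  assumes "finite B" "0 \<le> p" "p \<le> 1"
  shows "{\<omega>. \<forall>i\<in>B. \<omega> i} \<in> sets (bernoulli_law p :: (int ^ 'd::finite \<Rightarrow> bool) measure)"
    and "measure (bernoulli_law p) {\<omega> :: int ^ 'd \<Rightarrow> bool. \<forall>i\<in>B. \<omega> i} = p ^ card B"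
proof -
  interpret product_prob_space "\<lambda>i :: int ^ 'd. measure_pmf (bernoulli_pmf p)" UNIV
    by unfold_locales
  have eq: "{\<omega> :: int ^ 'd \<Rightarrow> bool. \<forall>i\<in>B. \<omega> i} =
      prod_emb UNIV (\<lambda>i. measure_pmf (bernoulli_pmf p)) B (Pi\<^sub>E B (\<lambda>i. {True}))"
    by (auto simp: prod_emb_def PiE_iff restrict_def) (metis (mono_tags))
  have "measure (bernoulli_law p) {\<omega> :: int ^ 'd \<Rightarrow> bool. \<forall>i\<in>B. \<omega> i}
      = (\<Prod>i\<in>B. measure (measure_pmf (bernoulli_pmf p)) {True})"
    unfolding eq bernoulli_law_def using assms by (intro measure_PiM_emb) auto
  also have "\<dots> = p ^ card B"
    using assms by (simp add: measure_pmf_single)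
  finally show "measure (bernoulli_law p) {\<omega> :: int ^ 'd \<Rightarrow> bool. \<forall>i\<in>B. \<omega> i} = p ^ card B" .
  show "{\<omega>. \<forall>i\<in>B. \<omega> i} \<in> sets (bernoulli_law p :: (int ^ 'd \<Rightarrow> bool) measure)"
    unfolding eq bernoulli_law_def using assms by (intro sets_PiM_I) auto
qed

text \<open>A union bound: a connected set of \<open>Suc n\<close> sites is the range of a walk of
  \<open>2 * n\<close> steps from \<open>a\<close>, and its sites in state 0 form a subset
  \<open>B\<close> with \<open>Suc n \<le> C * card B\<close>. Summing over walks and subsets gives
  a geometric series.\<close>

lemma dense_connected_set_prob:
  fixes E :: "((int ^ 'd::finite) \<times> (int ^ 'd)) set"
  assumes "sym E" "\<And>a. finite (E `` {a})" "\<And>a. card (E `` {a}) \<le> \<Delta>" "\<Delta> \<ge> 1"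
    and "0 \<le> p" "p \<le> (1 / (12 * real \<Delta> ^ 2)) ^ C"
    and "S \<in> sets (bernoulli_law p)"
    and "\<And>\<omega>. \<omega> \<in> S \<Longrightarrow>
      \<exists>A. finite A \<and> a \<in> A \<and> connected_in E A \<and> card A \<le> C * card {i\<in>A. \<omega> i}"
  shows "measure (bernoulli_law p) S \<le> 1 / 2"
proof -
  \<comment> \<open>Chosen so that \<open>real \<Delta> ^ 2 * 4 * r\<close> is 1/3; the powers
    \<open>(1 / 3) ^ Suc n\<close> then sum to 1/2.\<close>
  define r where "r = 1 / (12 * real \<Delta> ^ 2)"
  have "1 \<le> 12 * real \<Delta> ^ 2" using one_le_power[of "real \<Delta>" 2] assms(4) by linarith
  then have r: "0 < r" "r \<le> 1" using assms(4) by (simp_all only: r_def) (simp_all add: divide_le_eq)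
  have "p \<le> 1" using assms(6) power_le_one[of r C] r by (simp add: r_def)
  interpret prob_space "bernoulli_law p :: (int ^ 'd \<Rightarrow> bool) measure"
    unfolding bernoulli_law_def by (intro prob_space_PiM measure_pmf.prob_space_axioms)
  define T where "T n = (SIGMA xs : walks E a (2 * n). {B. B \<subseteq> set xs \<and> Suc n \<le> C * card B})" for n
  define Q where "Q B = {\<omega> :: int ^ 'd \<Rightarrow> bool. \<forall>i\<in>B. \<omega> i}" for B
  define F where "F n = (\<Union>z\<in>T n. Q (snd z))" for n
  note walks = finite_card_walks[where E = E, OF assms(2,3)]
  have T: "finite (T n)" "card (T n) \<le> \<Delta> ^ (2 * n) * 2 ^ Suc (2 * n)" for n
  proof -
    have sub: "T n \<subseteq> (SIGMA xs : walks E a (2 * n). Pow (set xs))" (is "_ \<subseteq> ?P")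
      by (auto simp: T_def)
    moreover have fin: "finite ?P" using walks by auto
    ultimately show "finite (T n)" by (rule finite_subset)
    have "card (T n) \<le> card ?P" using sub fin by (intro card_mono)
    also have "\<dots> = (\<Sum>xs\<in>walks E a (2 * n). 2 ^ card (set xs))"
      using walks by (subst card_SigmaI) (auto simp: card_Pow)
    also have "\<dots> \<le> (\<Sum>xs\<in>walks E a (2 * n). 2 ^ Suc (2 * n))"
    proof (intro sum_mono power_increasing)
      fix xs assume "xs \<in> walks E a (2 * n)"
      then show "card (set xs) \<le> Suc (2 * n)" using card_length[of xs] by (simp add: walks_def)
    qed simp
    also have "\<dots> \<le> \<Delta> ^ (2 * n) * 2 ^ Suc (2 * n)" using walks by simp
    finally show "card (T n) \<le> \<Delta> ^ (2 * n) * 2 ^ Suc (2 * n)" .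
  qed
  have Q: "Q (snd z) \<in> events \<and> prob (Q (snd z)) \<le> r ^ Suc n" if z: "z \<in> T n" for z n
  proof -
    have "snd z \<subseteq> set (fst z)" and B: "Suc n \<le> C * card (snd z)"
      using z by (auto simp: T_def)
    then have fin: "finite (snd z)" using finite_subset by blast
    have "prob (Q (snd z)) = p ^ card (snd z)"
      unfolding Q_def using fin assms(5) \<open>p \<le> 1\<close> by (rule bernoulli_law_all_True)
    \<comment> \<open>The exponent \<open>C\<close> in the bound on \<open>p\<close> turns the
      density of the set into one factor \<open>r\<close> for each of the \<open>Suc n\<close>
      sites.\<close>
    also have "\<dots> \<le> (r ^ C) ^ card (snd z)"
      using assms(5,6) by (intro power_mono) (auto simp: r_def)
    also have "\<dots> = r ^ (C * card (snd z))" by (simp add: power_mult)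
    also have "\<dots> \<le> r ^ Suc n" using B r by (intro power_decreasing) auto
    finally show ?thesis
      unfolding Q_def using bernoulli_law_all_True(1)[OF fin assms(5) \<open>p \<le> 1\<close>] by blast
  qed
  have F: "F n \<in> events" "prob (F n) \<le> (1 / 3) ^ Suc n" for n
  proof -
    show "F n \<in> events" unfolding F_def using T Q by (intro sets.finite_UN) auto
    have "prob (F n) \<le> (\<Sum>z\<in>T n. prob (Q (snd z)))"
      unfolding F_def using T Q by (intro measure_UNION_le) auto
    also have "\<dots> \<le> card (T n) * r ^ Suc n"
      using sum_mono[of "T n" "\<lambda>z. prob (Q (snd z))" "\<lambda>z. r ^ Suc n"] Q by simp
    also have "\<dots> \<le> (\<Delta> ^ (2 * n) * 2 ^ Suc (2 * n)) * r ^ Suc n"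
      using T(2)[of n] r by (intro mult_right_mono of_nat_mono) auto
    \<comment> \<open>Both exponents are rounded up so that the whole bound becomes a power with
      exponent \<open>Suc n\<close>.\<close>
    also have "\<dots> \<le> (real \<Delta> ^ (2 * Suc n) * 2 ^ (2 * Suc n)) * r ^ Suc n"
      unfolding of_nat_mult of_nat_power of_nat_numeral
      using assms(4) r by (intro mult_right_mono mult_mono power_increasing) auto
    also have "\<dots> = (real \<Delta> ^ 2 * 4 * r) ^ Suc n"
      unfolding power_mult power_mult_distrib by simp
    also have "real \<Delta> ^ 2 * 4 * r = 1 / 3"
      using assms(4) by (simp add: r_def)
    finally show "prob (F n) \<le> (1 / 3) ^ Suc n" .
  qed
  have geo: "(\<lambda>n. (1 / 3 :: real) ^ Suc n) sums (1 / 2)"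
    using sums_mult[OF geometric_sums[of "1 / 3 :: real"], of "1 / 3"] by simp
  have sumF: "summable (\<lambda>n. prob (F n))"
    using F(2) by (intro summable_comparison_test'[OF sums_summable[OF geo]]) auto
  have "S \<subseteq> (\<Union>n. F n)"
  proof
    fix \<omega> assume "\<omega> \<in> S"
    from assms(8)[OF this] obtain A where A: "finite A" "a \<in> A" "connected_in E A"
      "card A \<le> C * card {i\<in>A. \<omega> i}" by blast
    obtain xs where xs: "xs \<in> walks E a (2 * (card A - 1))" "set xs = A"
      using covering_walk[OF A(1,2,3) assms(1)] by blast
    have "card A > 0" using A by (auto simp: card_gt_0_iff)
    then have "(xs, {i\<in>A. \<omega> i}) \<in> T (card A - 1)" using xs A(4) by (auto simp: T_def)
    then have "\<omega> \<in> F (card A - 1)" unfolding F_def Q_def by force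
    then show "\<omega> \<in> (\<Union>n. F n)" by blast
  qed
  then have "prob S \<le> prob (\<Union>n. F n)"
    using F(1) by (intro finite_measure_mono sets.countable_UN) auto
  also have "\<dots> \<le> (\<Sum>n. prob (F n))"
    using F(1) sumF by (intro finite_measure_subadditive_countably) auto
  also have "\<dots> \<le> (\<Sum>n. (1 / 3) ^ Suc n)"
    using F(2) sumF sums_summable[OF geo] by (rule suminf_le)
  also have "\<dots> = 1 / 2" using geo by (rule sums_unique[symmetric])
  finally show ?thesis .
qed

section \<open>Stable directions\<close>

text \<open>The origin lies on the boundary of the open half space. If all of \<open>U\<close> lay
  inside, one step would infect the origin, against stability.\<close>

lemma stable_direction_reaches:
  assumes "u \<in> stable_directions \<U>" "U \<in> \<U>"
  shows "\<exists>x\<in>U. 0 \<le> real_site x \<bullet> u"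
proof (rule ccontr)
  let ?H = "lattice_points (half_space u)"
  assume "\<not> (\<exists>x\<in>U. 0 \<le> real_site x \<bullet> u)"
  then have "(+) 0 ` U \<subseteq> ?H" by (auto simp: lattice_points_def half_space_def)
  then have "0 \<in> bootstrap \<U> ?H (Suc 0)" using assms(2) by auto
  then have "0 \<in> bootstrap_closure \<U> ?H" unfolding bootstrap_closure_def by blast
  then have "0 \<in> ?H" using assms(1) by (simp add: stable_directions_def)
  then show False
    by (simp add: lattice_points_def half_space_def real_site_def zero_vec_def[symmetric])
qed

lemma real_site_eq_0 [simp]: "real_site x = 0 \<longleftrightarrow> x = 0"
  by (simp add: real_site_def vec_eq_iff)

lemma real_site_add: "real_site (x + y) = real_site x + real_site y"
  by (simp add: real_site_def vec_eq_iff)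

text \<open>An open set is not covered by finitely many hyperplanes, so a strongly stable direction may be
  perturbed to a stable one that is orthogonal to no site of the update family.\<close>

lemma strongly_stable_perturb:
  assumes "update_family \<U>" "u \<in> strongly_stable_directions \<U>" "u \<bullet> w < 0"
  shows "\<exists>v. v \<bullet> w < 0 \<and> (\<forall>U\<in>\<U>. \<exists>x\<in>U. 0 < real_site x \<bullet> v)"
proof -
  obtain T where T: "openin (top_of_set (sphere 0 1)) T" "u \<in> T" "T \<subseteq> stable_directions \<U>"
    using assms(2) by (auto simp: strongly_stable_directions_def interior_of_def)
  obtain G where G: "open G" "T = sphere 0 1 \<inter> G" using T(1) by (auto simp: openin_open)
  \<comment> \<open>The cone over \<open>G\<close>, cut by the half space of \<open>w\<close>. It is
    open in the whole space, hence not negligible, and \<open>sgn\<close> leads back to the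
    sphere.\<close>
  define N where "N = (- {0}) \<inter> sgn -` G \<inter> {v. v \<bullet> w < 0}"
  have "open ((- {0}) \<inter> sgn -` G)"
    by (intro continuous_open_preimage continuous_intros G) auto
  moreover have "open {v. v \<bullet> w < 0}" by (intro open_Collect_less continuous_intros)
  ultimately have "open N" unfolding N_def by blast
  have "norm u = 1" using T(2) G(2) by simp
  then have "sgn u = u" "u \<noteq> 0" by (auto simp: sgn_div_norm)
  then have "u \<in> N" using T(2) G(2) assms(3) by (simp add: N_def)
  \<comment> \<open>Update sets avoid the origin, so each of these finitely many sets is a genuine
    hyperplane.\<close>
  define Z where "Z = (\<Union>x\<in>\<Union>\<U>. {v. real_site x \<bullet> v = 0})"
  have "negligible Z"
    unfolding Z_def using assms(1)
    by (intro negligible_Union) (auto simp: update_family_def intro!: negligible_hyperplane)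
  moreover have "\<not> negligible N" using \<open>open N\<close> \<open>u \<in> N\<close> open_not_negligible by blast
  ultimately obtain v where v: "v \<in> N" "v \<notin> Z" using negligible_subset by blast
  have "sgn v \<in> T" using v(1) G(2) by (auto simp: N_def norm_sgn)
  have "\<exists>x\<in>U. 0 < real_site x \<bullet> v" if U: "U \<in> \<U>" for U
  proof -
    obtain x where x: "x \<in> U" "0 \<le> real_site x \<bullet> sgn v"
      using stable_direction_reaches U \<open>sgn v \<in> T\<close> T(3) by blast
    have "0 \<le> real_site x \<bullet> v"
      using x(2) v(1) by (simp add: sgn_div_norm N_def zero_le_mult_iff)
    moreover have "real_site x \<bullet> v \<noteq> 0" using v(2) x(1) U by (auto simp: Z_def)
    ultimately show ?thesis using x(1) by force
  qed
  then show ?thesis using v(1) by (auto simp: N_def)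
qed

text \<open>Otherwise a hyperplane separates 0 from the convex hull of the admissible directions,
  with normal \<open>w\<close>, say. The hemisphere opposite to \<open>w\<close> contains a strongly
  stable direction, and its perturbation is admissible but on the wrong side.\<close>

lemma subcritical_balanced_directions:
  assumes "update_family \<U>" "subcritical \<U>"
  shows "\<exists>I c. finite I \<and> I \<noteq> {} \<and> (\<forall>v\<in>I. 0 < c v) \<and> (\<Sum>v\<in>I. c v *\<^sub>R v) = 0 \<and>
    (\<forall>v\<in>I. \<forall>U\<in>\<U>. \<exists>x\<in>U. 0 < real_site x \<bullet> v)"
proof -
  define Q where "Q = {v. \<forall>U\<in>\<U>. \<exists>x\<in>U. 0 < real_site x \<bullet> v}"
  have "0 \<in> convex hull Q"
  proof (rule ccontr)
    assume "0 \<notin> convex hull Q"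
    then obtain w where w: "w \<noteq> 0" "\<And>v. v \<in> convex hull Q \<Longrightarrow> 0 \<le> w \<bullet> v"
      using separating_hyperplane_set_0[OF convex_convex_hull] by metis
    have "- sgn w \<in> sphere 0 1" using w(1) by (simp add: norm_sgn)
    then obtain u where u: "u \<in> open_hemisphere (- sgn w)" "u \<in> strongly_stable_directions \<U>"
      using assms(2) unfolding subcritical_def by blast
    have "u \<bullet> w < 0"
      using u(1) w(1) by (simp add: open_hemisphere_def sgn_div_norm mult_less_0_iff)
    then obtain v where "v \<bullet> w < 0" "v \<in> Q"
      using strongly_stable_perturb[OF assms(1) u(2)] unfolding Q_def by blast
    then show False using w(2)[of v] hull_inc[of v Q convex] by (simp add: inner_commute)
  qed
  then obtain S c where S: "finite S" "S \<subseteq> Q" "\<forall>v\<in>S. 0 \<le> c v" "sum c S = 1"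
    "(\<Sum>v\<in>S. c v *\<^sub>R v) = 0"
    unfolding convex_hull_explicit by auto
  \<comment> \<open>Zero weights are dropped, since each rescaled form has to increase strictly in
    its direction.\<close>
  define I where "I = {v\<in>S. c v \<noteq> 0}"
  have "I \<noteq> {}" using S(4) by (auto simp: I_def intro: ccontr)
  moreover have "(\<Sum>v\<in>I. c v *\<^sub>R v) = (\<Sum>v\<in>S. c v *\<^sub>R v)"
    using S(1) by (intro sum.mono_neutral_left) (auto simp: I_def)
  moreover have "finite I" "\<forall>v\<in>I. 0 < c v" "I \<subseteq> Q"
    using S by (auto simp: I_def less_le)
  ultimately show ?thesis using S(5) by (intro exI[of _ I] exI[of _ c]) (auto simp: Q_def)
qed

section \<open>From infection times to explanations\<close>

lemma bootstrap_excuse: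
  fixes \<U> :: "(int ^ 'd::finite) set set" and X :: "(int ^ 'd) set"
  defines "age \<equiv> \<lambda>y. LEAST t. y \<in> bootstrap \<U> X t"
  assumes "y \<in> bootstrap_closure \<U> X" "y \<notin> X"
  shows "\<exists>U\<in>\<U>. \<forall>x\<in>U. y + x \<in> bootstrap_closure \<U> X \<and> age (y + x) < age y"
proof -
  have "y \<in> bootstrap \<U> X (age y)"
    using assms(2) unfolding age_def bootstrap_closure_def by (auto intro: LeastI)
  \<comment> \<open>Age 0 would put \<open>y\<close> in \<open>X\<close>. At its first infection
    time \<open>Suc t\<close> the site is infected through an update set whose translate is already
    infected at time \<open>t\<close>.\<close>
  moreover obtain t where t: "age y = Suc t"
    using calculation assms(3) by (cases "age y") auto
  moreover have "y \<notin> bootstrap \<U> X t"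
    using t not_less_Least[of t "\<lambda>t. y \<in> bootstrap \<U> X t"] by (auto simp: age_def)
  ultimately obtain U where U: "U \<in> \<U>" "(+) y ` U \<subseteq> bootstrap \<U> X t"
    by auto
  have "y + x \<in> bootstrap_closure \<U> X \<and> age (y + x) < age y" if "x \<in> U" for x
  proof -
    have "y + x \<in> bootstrap \<U> X t" using U that by auto
    moreover from this have "age (y + x) \<le> t" unfolding age_def by (rule Least_le)
    ultimately show ?thesis using t by (auto simp: bootstrap_closure_def)
  qed
  then show ?thesis using U(1) by blast
qed

text \<open>Serves to rescale the linear forms so that their positive values on update sites are at
  least 1, as \<open>gain\<close> demands.\<close>

lemma uniformly_positive_scaling:
  fixes h :: "'a \<Rightarrow> real"
  assumes "finite S"
  shows "\<exists>K>0. \<forall>x\<in>S. 0 < h x \<longrightarrow> 1 \<le> K * h x"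
proof -
  \<comment> \<open>The inserted 1 covers an empty \<open>S\<close> and keeps \<open>K\<close>
    positive.\<close>
  define K where "K = Max (insert 1 ((\<lambda>x. 1 / h x) ` S))"
  have K: "1 \<le> K" "\<And>x. x \<in> S \<Longrightarrow> 1 / h x \<le> K"
    unfolding K_def using assms by (auto intro!: Max_ge)
  have "1 \<le> K * h x" if "x \<in> S" "0 < h x" for x
    using K(2)[OF that(1)] that(2) by (simp only: pos_divide_le_eq)
  then show ?thesis using K(1) by (intro exI[of _ K]) auto
qed

text \<open>Instantiates \<open>explanation\<close> with the balanced directions as charge types.
  Both \<open>E\<close> and \<open>C\<close> depend on the family alone and not on \<open>X\<close>,
  as the union bound requires.\<close>

lemma subcritical_dense_connected_set:
  fixes \<U> :: "(int ^ 'd::finite) set set"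
  assumes "update_family \<U>" "subcritical \<U>"
  defines "E \<equiv> {(a, b). b - a \<in> \<Union>\<U> \<or> a - b \<in> \<Union>\<U>}"
  shows "\<exists>C :: nat. \<forall>X. \<forall>y\<in>bootstrap_closure \<U> X.
    \<exists>A. finite A \<and> y \<in> A \<and> connected_in E A \<and> card A \<le> C * card (A \<inter> X)"
proof -
  obtain I c where I: "finite I" "I \<noteq> {}" "\<forall>v\<in>I. 0 < c v" "(\<Sum>v\<in>I. c v *\<^sub>R v) = 0"
    and reach: "\<forall>v\<in>I. \<forall>U\<in>\<U>. \<exists>x\<in>U. 0 < real_site x \<bullet> v"
    using subcritical_balanced_directions[OF assms(1,2)] by (elim exE conjE)
  have D: "finite (\<Union>\<U>)" using assms(1) by (auto simp: update_family_def)
  obtain K where K: "K > 0" "\<forall>z\<in>I \<times> \<Union>\<U>. 0 < c (fst z) * (real_site (snd z) \<bullet> fst z) \<longrightarrow>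
      1 \<le> K * (c (fst z) * (real_site (snd z) \<bullet> fst z))"
    using uniformly_positive_scaling[OF finite_cartesian_product[OF I(1) D],
        of "\<lambda>z. c (fst z) * (real_site (snd z) \<bullet> fst z)"] by (elim exE conjE)
  \<comment> \<open>The weights \<open>c v\<close> make the forms sum to 0, and \<open>K\<close>
    provides the gain of 1.\<close>
  define L where "L v x = K * (c v * (real_site x \<bullet> v))" for v x
  have L_add: "L v (x + y) = L v x + L v y" for v x y
    by (simp add: L_def real_site_add inner_add_left algebra_simps)
  have sum_L: "(\<Sum>v\<in>I. L v x) = 0" for x
  proof -
    have "(\<Sum>v\<in>I. L v x) = K * (real_site x \<bullet> (\<Sum>v\<in>I. c v *\<^sub>R v))"
      by (simp add: L_def inner_sum_right sum_distrib_left)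
    then show ?thesis by (simp only: I(4) inner_zero_right mult_zero_right)
  qed
  have L_reach: "\<exists>x\<in>U. 1 \<le> L v x" if v: "v \<in> I" and U: "U \<in> \<U>" for v U
  proof -
    obtain x where x: "x \<in> U" "0 < real_site x \<bullet> v" using reach v U by blast
    then have "0 < c v * (real_site x \<bullet> v)" using I(3) v by simp
    then have "1 \<le> L v x" using bspec[OF K(2), of "(v, x)"] x(1) v U by (auto simp: L_def)
    then show ?thesis using x(1) by blast
  qed
  \<comment> \<open>The inserted 0 keeps \<open>\<Lambda>\<close> nonnegative, whence
    \<open>1 \<le> C\<close>.\<close>
  define \<Lambda> where "\<Lambda> = Max (insert 0 ((\<lambda>(v, x). L v x) ` (I \<times> \<Union>\<U>)))"
  have \<Lambda>: "0 \<le> \<Lambda>" "\<And>v x. v \<in> I \<Longrightarrow> x \<in> \<Union>\<U> \<Longrightarrow> L v x \<le> \<Lambda>"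
    unfolding \<Lambda>_def using I(1) D by (force intro!: Max_ge)+
  define C where "C = nat \<lceil>2 + card I * \<Lambda>\<rceil>"
  have C: "2 + card I * \<Lambda> \<le> C" unfolding C_def by linarith
  moreover have "0 \<le> card I * \<Lambda>" using \<Lambda>(1) by simp
  ultimately have "1 \<le> real C" by linarith
  show ?thesis
  proof (intro exI[of _ C] allI ballI)
    fix X y assume y: "y \<in> bootstrap_closure \<U> X"
    define V where "V = bootstrap_closure \<U> X"
    define age where "age z = (LEAST t. z \<in> bootstrap \<U> X t)" for z
    \<comment> \<open>For every direction, an update set that infects \<open>z\<close> contains a
      site advancing by at least 1.\<close>
    have "\<exists>x\<in>\<Union>\<U>. 1 \<le> L v x \<and> z + x \<in> V \<and> age (z + x) < age z"
      if "v \<in> I" "z \<in> V - X" for v z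
      using bootstrap_excuse[of z \<U> X] L_reach[OF that(1)] that(2)
      unfolding V_def age_def by (metis DiffD1 DiffD2 UnionI)
    then obtain e where e: "\<And>v z. v \<in> I \<Longrightarrow> z \<in> V - X \<Longrightarrow>
        e v z \<in> \<Union>\<U> \<and> 1 \<le> L v (e v z) \<and> z + e v z \<in> V \<and> age (z + e v z) < age z"
      by metis
    interpret explanation I V X "\<lambda>v z. z + e v z" L age \<Lambda> C
      using I(1,2) sum_L e \<Lambda>(2) C \<open>1 \<le> real C\<close> by unfold_locales (auto simp: L_add)
    have "arrows \<subseteq> E" using e by (auto simp: arrows_def E_def)
    moreover obtain A where "finite A" "y \<in> A" "connected_in arrows A" "card A \<le> real C * card (A \<inter> X)"
      using dense_connected_set_at y by (auto simp: V_def)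
    moreover from this(4) have "card A \<le> C * card (A \<inter> X)"
      by (metis of_nat_le_iff of_nat_mult)
    ultimately show "\<exists>A. finite A \<and> y \<in> A \<and> connected_in E A \<and> card A \<le> C * card (A \<inter> X)"
      using connected_in_mono by blast
  qed
qed

theorem theorem1p1:
  fixes \<U> :: "(int ^ 'd::finite) set set"
  assumes "CARD('d) \<ge> 2"
    and "update_family \<U>"
    and "subcritical \<U>"
  shows "critical_prob \<U> > 0"
proof -
  define D where "D = \<Union>\<U> \<union> uminus ` \<Union>\<U>"
  define E where "E = {(a, b). b - a \<in> \<Union>\<U> \<or> a - b \<in> \<Union>\<U>}"
  \<comment> \<open>The successor ensures \<open>1 \<le> \<Delta>\<close> even for empty
    \<open>D\<close>.\<close>
  define \<Delta> where "\<Delta> = Suc (card D)"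
  obtain C :: nat where C: "\<And>X y. y \<in> bootstrap_closure \<U> X \<Longrightarrow>
      \<exists>A. finite A \<and> y \<in> A \<and> connected_in E A \<and> card A \<le> C * card (A \<inter> X)"
    using subcritical_dense_connected_set[OF assms(2,3)] unfolding E_def by blast
  have "finite D" using assms(2) by (auto simp: D_def update_family_def)
  have E_sub: "E `` {a} \<subseteq> (+) a ` D" for a
  proof
    fix b assume "b \<in> E `` {a}"
    then have "b - a \<in> \<Union>\<U> \<or> - (b - a) \<in> \<Union>\<U>" by (simp add: E_def)
    then have "b - a \<in> D" unfolding D_def by (metis Un_iff image_eqI minus_minus)
    then show "b \<in> (+) a ` D" by (auto intro: image_eqI[of _ _ "b - a"])
  qed
  have E_fin: "finite (E `` {a})" for a
    using E_sub finite_imageI[OF \<open>finite D\<close>] by (rule finite_subset)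
  have E_card: "card (E `` {a}) \<le> \<Delta>" for a
    using card_mono[OF finite_imageI[OF \<open>finite D\<close>] E_sub[of a]]
      card_image_le[OF \<open>finite D\<close>, of "(+) a"] unfolding \<Delta>_def by linarith
  define p0 where "p0 = (1 / (12 * real \<Delta> ^ 2)) ^ C"
  have "p0 > 0" by (simp add: p0_def \<Delta>_def)
  \<comment> \<open>Percolation infects the origin, so the estimate applies to connected sets around
    it.\<close>
  have le_half: "measure (bernoulli_law p) (percolation_event \<U>) \<le> 1 / 2" if "0 \<le> p" "p \<le> p0" for p
  proof (rule dense_connected_set_prob[where E = E and a = 0 and C = C and \<Delta> = \<Delta>])
    show "sym E" by (auto simp: sym_def E_def)
    show "1 \<le> \<Delta>" by (simp add: \<Delta>_def)
    show "p \<le> (1 / (12 * real \<Delta> ^ 2)) ^ C" using that by (simp add: p0_def)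
    show "percolation_event \<U> \<in> sets (bernoulli_law p)"
      using assms(2) by (rule percolation_event_measurable)
    fix \<omega> assume "\<omega> \<in> percolation_event \<U>"
    then have "0 \<in> bootstrap_closure \<U> {i. \<omega> i}" by (simp add: percolation_event_def)
    from C[OF this] show
      "\<exists>A. finite A \<and> 0 \<in> A \<and> connected_in E A \<and> card A \<le> C * card {i\<in>A. \<omega> i}"
      by (simp add: Int_def)
  qed (use E_fin E_card that in auto)
  \<comment> \<open>A parameter with percolation probability 1 must exceed \<open>p0\<close>, and
    the infimum is over a nonempty set since it contains 1.\<close>
  have "p0 \<le> critical_prob \<U>"
    unfolding critical_prob_def
  proof (rule cInf_greatest)
    show "{p \<in> {0..1}. measure (bernoulli_law p) (percolation_event \<U>) = 1} \<noteq> {}"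
      using one_percolates[OF assms(2)] by force
    fix p assume p: "p \<in> {p \<in> {0..1}. measure (bernoulli_law p) (percolation_event \<U>) = 1}"
    show "p0 \<le> p"
      using le_half[of p] p by (cases "p \<le> p0") auto
  qed
  then show ?thesis using \<open>p0 > 0\<close> by simp
qed

end
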